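(* Let $g(n)=1$ for all $n\in\mathbb{N}$. Define polynomials $P_n(x)$ by $P_0(x)=1$ and $P_n(x)=\frac{x}{n}\sum_{k=1}^{n} g(k)\,P_{n-k}(x)$ for $n\geq 1$, and put $\Delta_n(x)=\left(P_n(x)\right)^{n+1}-\left(P_{n+1}(x)\right)^{n}$. Then $$P_n(x)=\frac{1}{n!}\prod_{k=0}^{n-1}(x+k)\quad (n\geq 0),$$ and for every $n\geq 2$ the largest real zero $x_n$ of $\Delta_n(x)$ equals $1$ $(=g(2))$.
   Context: $\Delta_n(x)$ is a nonzero real polynomial for $n\geq 1$, and $x=0$ is one of its real zeros since $P_n(0)=0$ for $n\geq1$; $x_n$ denotes its largest real zero. *)

theory Defs
  imports Complex_Main "HOL-Computational_Algebra.Polynomial"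
begin

text \<open>Here \<open>[:0, 1:]\<close> is the indeterminate \<open>x\<close>. Only the values \<open>g k\<close> with \<open>k \<ge> 1\<close> are used.\<close>

fun P :: "(nat \<Rightarrow> real) \<Rightarrow> nat \<Rightarrow> real poly" where
  "P g 0 = 1"
| "P g (Suc n) =
     smult (1 / real (Suc n)) ([:0, 1:] * (\<Sum>k = 1..Suc n. smult (g k) (P g (Suc n - k))))"

definition Delta :: "(nat \<Rightarrow> real) \<Rightarrow> nat \<Rightarrow> real poly" where
  "Delta g n = P g n ^ (n + 1) - P g (n + 1) ^ n"

text \<open>A predicate rather than a function: no value is assigned to a polynomial
  without a largest real zero (in particular to the zero polynomial).\<close>

definition is_largest_real_zero :: "real poly \<Rightarrow> real \<Rightarrow> bool" where
  "is_largest_real_zero p x \<longleftrightarrow> poly p x = 0 \<and> (\<forall>y. poly p y = 0 \<longrightarrow> y \<le> x)"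

end

theory Submission
  imports Defs
begin

text \<open>Since \<open>g = 1\<close>, consecutive instances of the recurrence telescope to
  \<open>(n + 1) P\<^sub>n\<^sub>+\<^sub>1 = (x + n) P\<^sub>n\<close>, which gives the product formula. It also shows that
  \<open>\<Delta>\<^sub>n = P\<^sub>n\<^sup>n (P\<^sub>n - ((x + n) / (n + 1))\<^sup>n)\<close>. For \<open>x > 1\<close> each of the \<open>n\<close> factors
  \<open>(x + k) / (k + 1) = 1 + (x - 1) / (k + 1)\<close> of \<open>P\<^sub>n\<close>, where \<open>k < n\<close>, exceeds
  \<open>1 + (x - 1) / (n + 1) = (x + n) / (n + 1)\<close>, so \<open>\<Delta>\<^sub>n\<close> has no zero beyond \<open>1\<close>.\<close>

lemma P_Suc_eq_sum:
  assumes "\<forall>n\<ge>1. g n = 1"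
  shows "smult (real (Suc n)) (P g (Suc n)) = [:0, 1:] * (\<Sum>j\<le>n. P g j)"
proof -
  have "(\<Sum>k = 1..Suc n. smult (g k) (P g (Suc n - k))) = (\<Sum>j\<le>n. P g j)"
    by (rule sum.reindex_bij_witness[of _ "\<lambda>j. Suc n - j" "\<lambda>k. Suc n - k"])
       (use assms in auto)
  then show ?thesis
    by simp
qed

lemma P_Suc:
  assumes "\<forall>n\<ge>1. g n = 1"
  shows "P g (Suc n) = smult (1 / real (Suc n)) ([:real n, 1:] * P g n)"
proof -
  have "smult (real (Suc n)) (P g (Suc n)) = [:real n, 1:] * P g n"
  proof (cases n)
    case 0
    then show ?thesis
      using P_Suc_eq_sum[of g 0] assms by simp
  next
    case (Suc m)
    \<comment> \<open>Splitting off the summand \<open>P g (Suc m)\<close> leaves the sum that the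
      previous instance of the recurrence evaluates. For \<open>n = 0\<close> there is no previous
      instance, hence the case split.\<close>
    have "smult (real (Suc n)) (P g (Suc n))
        = [:0, 1:] * (\<Sum>j\<le>m. P g j) + [:0, 1:] * P g (Suc m)"
      using P_Suc_eq_sum[of g n] assms unfolding Suc
      by (simp add: distrib_left del: P.simps mult_pCons_left)
    also have "\<dots> = smult (real n) (P g n) + [:0, 1:] * P g n"
      using P_Suc_eq_sum[of g m] assms unfolding Suc by simp
    finally show ?thesis
      by simp
  qed
  then have "smult (1 / real (Suc n)) (smult (real (Suc n)) (P g (Suc n)))
      = smult (1 / real (Suc n)) ([:real n, 1:] * P g n)"
    by simp
  then show ?thesis
    by (simp del: P.simps mult_pCons_left of_nat_Suc)
qed

lemma P_eq_prod:
  assumes "\<forall>n\<ge>1. g n = 1"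
  shows "P g n = smult (1 / fact n) (\<Prod>k = 0..<n. [:real k, 1:])"
proof (induction n)
  case 0
  show ?case by simp
next
  case (Suc n)
  have "P g (Suc n) = smult (1 / real (Suc n)) ([:real n, 1:] * P g n)"
    using P_Suc assms by blast
  then show ?case
    unfolding Suc.IH by (simp add: mult.commute del: P.simps mult_pCons_left mult_pCons_right)
qed

text \<open>Spreading \<open>fact n\<close> over the linear factors prepares a comparison factor by
  factor.\<close>

lemma poly_P_eq_prod:
  assumes "\<forall>n\<ge>1. g n = 1"
  shows "poly (P g n) x = (\<Prod>k<n. (x + real k) / real (Suc k))"
  unfolding P_eq_prod[OF assms]
  by (simp add: poly_prod prod_dividef fact_prod_Suc lessThan_atLeast0 add.commute)

lemma power_less_poly_P:
  assumes "\<forall>n\<ge>1. g n = 1" and "x > 1" and "n \<ge> 1"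
  shows "((x + real n) / real (Suc n)) ^ n < poly (P g n) x"
proof -
  have less: "(x + real n) / real (Suc n) < (x + real k) / real (Suc k)" if "k < n" for k
  proof -
    \<comment> \<open>This product equals the cross-multiplied difference
      \<open>(x + k) * (n + 1) - (x + n) * (k + 1)\<close>.\<close>
    have "0 < (x - 1) * (real n - real k)"
      using assms(2) that by simp
    then show ?thesis
      by (simp add: field_simps)
  qed
  have "(\<Prod>k<n. (x + real n) / real (Suc n)) < (\<Prod>k<n. (x + real k) / real (Suc k))"
    \<comment> \<open>The index \<open>0\<close>, present because \<open>n \<ge> 1\<close>,
      witnesses strictness.\<close>
    by (rule prod_mono_strict[of 0]) (use assms(2,3) less less[of 0] in \<open>auto intro: less_imp_le\<close>)
  then show ?thesis
    unfolding poly_P_eq_prod[OF assms(1)] by simp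
qed

lemma poly_Delta_eq:
  assumes "\<forall>n\<ge>1. g n = 1"
  shows "poly (Delta g n) x
      = poly (P g n) x ^ n * (poly (P g n) x - ((x + real n) / real (Suc n)) ^ n)"
proof -
  have "poly (P g (Suc n)) x = poly (P g n) x * ((x + real n) / real (Suc n))"
    unfolding poly_P_eq_prod[OF assms] by simp
  then have "poly (P g (Suc n)) x ^ n
      = poly (P g n) x ^ n * ((x + real n) / real (Suc n)) ^ n"
    by (simp only: power_mult_distrib)
  then show ?thesis
    unfolding Delta_def by (simp add: right_diff_distrib mult.commute del: P.simps)
qed

lemma is_largest_real_zero_Delta:
  assumes "\<forall>n\<ge>1. g n = 1" and "n \<ge> 1"
  shows "is_largest_real_zero (Delta g n) 1"
proof -
  \<comment> \<open>At \<open>1\<close> every factor \<open>(1 + k) / (k + 1)\<close> is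
    \<open>1\<close>.\<close>
  have "poly (P g n) 1 = 1"
    unfolding poly_P_eq_prod[OF assms(1)] by (simp add: add.commute)
  then have "poly (Delta g n) 1 = 0"
    unfolding poly_Delta_eq[OF assms(1)] by (simp add: add.commute)
  moreover have "poly (Delta g n) y \<noteq> 0" if "y > 1" for y
  proof -
    have less: "((y + real n) / real (Suc n)) ^ n < poly (P g n) y"
      using power_less_poly_P assms that by blast
    \<comment> \<open>With this bound \<open>P g n\<close> is positive at \<open>y\<close>, so
      neither factor of \<open>Delta g n\<close> vanishes there.\<close>
    moreover have "0 \<le> ((y + real n) / real (Suc n)) ^ n"
      using that by simp
    ultimately have "poly (P g n) y > 0"
      by linarith
    with less show ?thesis
      unfolding poly_Delta_eq[OF assms(1)] by simp
  qed
  ultimately show ?thesis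
    unfolding is_largest_real_zero_def by (meson not_le)
qed

theorem theorem1p1:
  fixes g :: "nat \<Rightarrow> real"
  assumes "\<And>n. n \<ge> 1 \<Longrightarrow> g n = 1"
  shows "(\<forall>n. P g n = smult (1 / fact n) (\<Prod>k = 0..<n. [:real k, 1:])) \<and>
         (\<forall>n\<ge>2. is_largest_real_zero (Delta g n) 1) \<and> g 2 = 1"
proof -
  have "\<forall>n\<ge>1. g n = 1"
    using assms by blast
  then show ?thesis
    using P_eq_prod is_largest_real_zero_Delta by auto
qed

end
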